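(* The aggregation functor restricts to a functor $\mathsf{Q}\colon \mathbf{Phy}\to\mathbf{Comp}$, and $$\mathsf{Q}\colon (\mathbf{Phy},\mathbf{Phy}_{\mathsf f})\to(\mathbf{Comp},\mathbf{Comp}_{\mathsf f})$$ is a resource reflecting functor of resource theories; that is, $\mathsf{Q}$ sends every morphism of $\mathbf{Phy}_{\mathsf f}$ to a morphism of $\mathbf{Comp}_{\mathsf f}$, and for every morphism $M$ of $\mathbf{Phy}$, if $\mathsf{Q}M$ belongs to $\mathbf{Comp}_{\mathsf f}$ then $M$ belongs to $\mathbf{Phy}_{\mathsf f}$.
   Context: Composition is written in diagrammatic order. A matrix of shape $(X,Y)$, for sets $X,Y$, is a function $M\colon X\times Y\to\mathbb{R}$ with entries $M_{x,y}$ and rows $M_{x,-}$. A subdistribution on $X$ is a finitely supported function $p\colon X\to[0,1]$ with $\sum_x p_x\le 1$; it is a distribution if the sum is $1$; $\operatorname{supp}p=\{x: p_x\neq 0\}$. A subdistribution matrix is a matrix whose rows are all subdistributions. Products: $(MN)_{x,z}=\sum_y M_{x,y}N_{y,z}$ and $(pM)_y=\sum_x p_xM_{x,y}$. $\operatorname{supp}M=\{x\in X:\exists y,\ M_{x,y}\ne0\}$. Kronecker product: $(M\otimes N)_{(x,u),(y,v)}=M_{x,y}N_{u,v}$. $\mathbf 1$ is a one-point set. Copy matrix $\Delta_X$ of shape $(X,X\times X)$: entry $1$ at $(x,(x_1,x_2))$ if $x_1=x=x_2$, else $0$. Discard matrix $E_X$ of shape $(X,\mathbf 1)$: all entries $1$.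 A subdistribution matrix $M$ of shape $(X,Y)$ is deterministic if $\Delta_X(M\otimes M)=M\Delta_Y$. Its domain of definition is $\overline M=\Delta_X(\mathrm{id}_X\otimes(ME_Y))$, a matrix of shape $(X,X)$ (identifying $X\times\mathbf 1$ with $X$). A partial inverse of $M$ is a subdistribution matrix $N$ of shape $(Y,X)$ with $MN=\overline M$ and $NM=\overline N$. A partitioned set $(X,\sim)$ is a set with an equivalence relation. Subdistributions $p,q$ on $X$ are equivalent, $p\sim q$, if $\sum_{x'\in[x]}p_{x'}=\sum_{x'\in[x]}q_{x'}$ for all $x\in X$. A subdistribution matrix $M$ of shape $(X,Y)$, with $(X,\sim),(Y,\sim)$ partitioned sets, is partitioned if $p\sim q$ implies $pM\sim qM$ for all subdistributions $p,q$ on $X$. Aggregation: $\mathsf{Q}(X,\sim)=X/{\sim}$; $\mathsf{Q}M$ is the matrix of shape $(X/{\sim},Y/{\sim})$ with $(\mathsf{Q}M)_{[x],[y]}=\sum_{y'\in[y]}M_{x,y'}$; for a distribution $p$ on a partitioned set $(X,\sim)$, $\mathsf{Q}(p)_{[x]}=\sum_{x'\in[x]}p_{x'}$. Entropy: $\mathsf H(p)=-\sum_x p_x\log p_x$ with $0\log 0=0$. $\mathbf{Comp}$: objects are computational contexts, i.e. distributions $p$ on sets $X$; a morphism (computational transformation) $M\colon p\rightsquigarrow q$, with $p$ on $X$ and $q$ on $Y$, is a subdistribution matrix of shape $(X,Y)$ with $pM=q$. $\mathbf{Phy}$: objects are physical contexts, i.e. distributions on partitioned sets; a morphism (physical transformation)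 $M\colon p\rightsquigarrow q$ is a partitioned subdistribution matrix with $pM=q$ and $\mathsf H(p)=\mathsf H(q)$. Composition in both is matrix multiplication. The functor $\mathsf{Q}\colon\mathbf{Phy}\to\mathbf{Comp}$ sends $p$ to $\mathsf{Q}(p)$ and $M$ to $\mathsf{Q}M$. For a physical context $p$: $\mathsf H_{\mathrm{phy}}(p)=\mathsf H(p)$, $\mathsf H_{\mathrm{comp}}(p)=\mathsf H(\mathsf{Q}(p))$, $\mathsf H_{\mathrm{nc}}(p)=\mathsf H_{\mathrm{phy}}(p)-\mathsf H_{\mathrm{comp}}(p)$. A physical transformation $M\colon p\rightsquigarrow q$ is non-entropy-ejecting if $\mathsf H_{\mathrm{nc}}(q)\le\mathsf H_{\mathrm{nc}}(p)$. A deterministic computational transformation $M\colon p\rightsquigarrow q$ is conditionally reversible if $\operatorname{supp}p\subseteq\operatorname{supp}M$ and the matrix $M|_p$ of shape $(\operatorname{supp}p,Y)$, $(x,y)\mapsto M_{x,y}$, has a partial inverse. A resource theory is a pair $(\mathbb X,\mathbb X_{\mathsf f})$ of a category and a wide subcategory (of free transformations). A functor of resource theories $(\mathbb X,\mathbb X_{\mathsf f})\to(\mathbb Y,\mathbb Y_{\mathsf f})$ is a functor $F\colon\mathbb X\to\mathbb Y$ with $F(\mathbb X_{\mathsf f})\subseteq\mathbb Y_{\mathsf f}$; it is resource reflecting if $F(f)\in\mathbb Y_{\mathsf f}$ implies $f\in\mathbb X_{\mathsf f}$. $\mathbf{Phy}_{\mathsf f}$ is the wide subcategory of $\mathbf{Phy}$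 on the physical transformations $M$ that are non-entropy-ejecting and such that $\mathsf{Q}M$ is deterministic. $\mathbf{Comp}_{\mathsf f}$ is the wide subcategory of $\mathbf{Comp}$ on the conditionally reversible (in particular deterministic) computational transformations. *)

theory Defs
  imports Complex_Main
begin

section \<open>Subdistributions and matrices\<close>

text \<open>
  Functions and matrices on sets are extended by zero: a subdistribution on \<open>X\<close> vanishes
  outside \<open>X\<close>, a matrix of shape \<open>(X, Y)\<close> vanishes outside \<open>X \<times> Y\<close>, so that equality of matrices
  of the same shape is equality of functions and sums over an index set may be taken over the whole
  type. The library function \<^const>\<open>sum'\<close> sums over the indices with non-zero value, hence
  computes finitely supported sums over possibly infinite index sets.
\<close>

type_synonym ('a, 'b) matrix = "'a \<Rightarrow> 'b \<Rightarrow> real"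

definition supp :: "('a \<Rightarrow> real) \<Rightarrow> 'a set" where
  "supp p = {x. p x \<noteq> 0}"

definition subdistribution :: "'a set \<Rightarrow> ('a \<Rightarrow> real) \<Rightarrow> bool" where
  "subdistribution X p \<longleftrightarrow>
     supp p \<subseteq> X \<and> finite (supp p) \<and> (\<forall>x. 0 \<le> p x \<and> p x \<le> 1) \<and> sum' p X \<le> 1"

definition distribution :: "'a set \<Rightarrow> ('a \<Rightarrow> real) \<Rightarrow> bool" where
  "distribution X p \<longleftrightarrow> subdistribution X p \<and> sum' p X = 1"

definition subdist_matrix :: "'a set \<Rightarrow> 'b set \<Rightarrow> ('a, 'b) matrix \<Rightarrow> bool" where
  "subdist_matrix X Y M \<longleftrightarrow>
     (\<forall>x\<in>X. subdistribution Y (M x)) \<and> (\<forall>x. x \<notin> X \<longrightarrow> M x = (\<lambda>y. 0))"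

definition mat_mult :: "('a, 'b) matrix \<Rightarrow> ('b, 'c) matrix \<Rightarrow> ('a, 'c) matrix" (infixl "\<cdot>" 70) where
  "M \<cdot> N = (\<lambda>x z. sum' (\<lambda>y. M x y * N y z) UNIV)"

definition dist_mult :: "('a \<Rightarrow> real) \<Rightarrow> ('a, 'b) matrix \<Rightarrow> 'b \<Rightarrow> real" (infixl "\<bullet>" 70) where
  "p \<bullet> M = (\<lambda>y. sum' (\<lambda>x. p x * M x y) UNIV)"

definition mat_supp :: "('a, 'b) matrix \<Rightarrow> 'a set" where
  "mat_supp M = {x. \<exists>y. M x y \<noteq> 0}"

definition kronecker ::
    "('a, 'b) matrix \<Rightarrow> ('c, 'd) matrix \<Rightarrow> ('a \<times> 'c, 'b \<times> 'd) matrix" (infixr "\<otimes>" 75) where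
  "M \<otimes> N = (\<lambda>(x, u) (y, v). M x y * N u v)"

definition id_mat :: "'a set \<Rightarrow> ('a, 'a) matrix" where
  "id_mat X = (\<lambda>x y. if x \<in> X \<and> x = y then 1 else 0)"

definition copy_mat :: "'a set \<Rightarrow> ('a, 'a \<times> 'a) matrix" where
  "copy_mat X = (\<lambda>x (x1, x2). if x \<in> X \<and> x1 = x \<and> x2 = x then 1 else 0)"

definition discard_mat :: "'a set \<Rightarrow> ('a, unit) matrix" where
  "discard_mat X = (\<lambda>x _. if x \<in> X then 1 else 0)"

definition deterministic :: "'a set \<Rightarrow> 'b set \<Rightarrow> ('a, 'b) matrix \<Rightarrow> bool" where
  "deterministic X Y M \<longleftrightarrow>
     subdist_matrix X Y M \<and> copy_mat X \<cdot> (M \<otimes> M) = M \<cdot> copy_mat Y"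

text \<open>The column index \<open>(x', ())\<close> realises the identification of \<open>X \<times> 1\<close> with \<open>X\<close>.\<close>

definition domain_of_definition :: "'a set \<Rightarrow> 'b set \<Rightarrow> ('a, 'b) matrix \<Rightarrow> ('a, 'a) matrix" where
  "domain_of_definition X Y M =
     (\<lambda>x x'. (copy_mat X \<cdot> (id_mat X \<otimes> (M \<cdot> discard_mat Y))) x (x', ()))"

definition partial_inverse ::
    "'a set \<Rightarrow> 'b set \<Rightarrow> ('a, 'b) matrix \<Rightarrow> ('b, 'a) matrix \<Rightarrow> bool" where
  "partial_inverse X Y M N \<longleftrightarrow>
     subdist_matrix Y X N \<and>
     M \<cdot> N = domain_of_definition X Y M \<and> N \<cdot> M = domain_of_definition Y X N"

definition entropy :: "('a \<Rightarrow> real) \<Rightarrow> real" where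
  "entropy p = - sum' (\<lambda>x. p x * ln (p x)) UNIV"


section \<open>Partitioned sets and aggregation\<close>

definition dist_equiv :: "'a set \<Rightarrow> ('a \<times> 'a) set \<Rightarrow> ('a \<Rightarrow> real) \<Rightarrow> ('a \<Rightarrow> real) \<Rightarrow> bool" where
  "dist_equiv X r p q \<longleftrightarrow> (\<forall>x\<in>X. sum' p (r `` {x}) = sum' q (r `` {x}))"

definition partitioned ::
    "'a set \<Rightarrow> ('a \<times> 'a) set \<Rightarrow> 'b set \<Rightarrow> ('b \<times> 'b) set \<Rightarrow> ('a, 'b) matrix \<Rightarrow> bool" where
  "partitioned X r Y s M \<longleftrightarrow>
     subdist_matrix X Y M \<and>
     (\<forall>p q. subdistribution X p \<longrightarrow> subdistribution X q \<longrightarrow>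
        dist_equiv X r p q \<longrightarrow> dist_equiv Y s (p \<bullet> M) (q \<bullet> M))"

definition Q_dist :: "'a set \<Rightarrow> ('a \<times> 'a) set \<Rightarrow> ('a \<Rightarrow> real) \<Rightarrow> 'a set \<Rightarrow> real" where
  "Q_dist X r p = (\<lambda>C. if C \<in> X // r then sum' p C else 0)"

definition Q_mat ::
    "'a set \<Rightarrow> ('a \<times> 'a) set \<Rightarrow> 'b set \<Rightarrow> ('b \<times> 'b) set \<Rightarrow> ('a, 'b) matrix \<Rightarrow>
     ('a set, 'b set) matrix" where
  "Q_mat X r Y s M =
     (\<lambda>C D. if C \<in> X // r \<and> D \<in> Y // s then sum' (M (SOME x. x \<in> C)) D else 0)"

text \<open>For partitioned matrices, aggregation does not depend on the chosen representative.\<close>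

lemma Q_mat_class:
  assumes X: "equiv X r" and Y: "equiv Y s" and M: "partitioned X r Y s M"
    and x: "x \<in> X" and y: "y \<in> Y"
  shows "Q_mat X r Y s M (r `` {x}) (s `` {y}) = sum' (M x) (s `` {y})"
proof -
  define \<delta> :: "'a \<Rightarrow> 'a \<Rightarrow> real" where "\<delta> = (\<lambda>a b. if b = a then 1 else 0)"
  have supp: "supp (\<delta> a) = {a}" for a
    by (auto simp: supp_def \<delta>_def)
  have sum_\<delta>: "sum' (\<lambda>b. \<delta> a b * f b) A = (if a \<in> A then f a else 0)"
    for a A and f :: "'a \<Rightarrow> real"
  proof -
    have "sum' (\<lambda>b. \<delta> a b * f b) A = sum' (\<lambda>b. \<delta> a b * f b) (A \<inter> {a})"
      by (rule sum.mono_neutral_right') (auto simp: \<delta>_def)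
    then show ?thesis
      by (cases "a \<in> A") (auto simp: \<delta>_def sum.eq_sum)
  qed
  have sum1: "sum' (\<delta> a) A = (if a \<in> A then 1 else 0)" for a A
    using sum_\<delta>[of a "\<lambda>_. 1" A] by simp
  have sub: "subdistribution X (\<delta> a)" if "a \<in> X" for a
    using that by (auto simp: subdistribution_def supp sum1) (auto simp: \<delta>_def)
  have mult: "\<delta> a \<bullet> M = M a" for a
    by (auto simp: dist_mult_def sum_\<delta>)
  define x' where "x' = (SOME z. z \<in> r `` {x})"
  have "x' \<in> r `` {x}"
    unfolding x'_def using equiv_class_self[OF X x] by (rule someI)
  then have xx': "(x, x') \<in> r"
    by simp
  then have x': "x' \<in> X"
    using X by (auto simp: equiv_def refl_on_def)
  have "x \<in> r `` {z} \<longleftrightarrow> x' \<in> r `` {z}" for z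
    using xx' X by (auto simp: equiv_def dest: symD transD)
  then have "dist_equiv X r (\<delta> x') (\<delta> x)"
    by (simp add: dist_equiv_def sum1)
  then have "dist_equiv Y s (M x') (M x)"
    using M sub[OF x] sub[OF x'] unfolding partitioned_def by (metis mult)
  then have "sum' (M x') (s `` {y}) = sum' (M x) (s `` {y})"
    using y by (simp add: dist_equiv_def)
  then show ?thesis
    using x y by (simp add: Q_mat_def quotientI x'_def)
qed


section \<open>Categories and resource theories\<close>

text \<open>Composition \<open>Cmp C f g\<close> is in diagrammatic order and relevant only if \<open>Cod C f = Dom C g\<close>.\<close>

record ('o, 'm) precategory =
  Ob :: "'o set"
  Ar :: "'m set"
  Dom :: "'m \<Rightarrow> 'o"
  Cod :: "'m \<Rightarrow> 'o"
  Idn :: "'o \<Rightarrow> 'm"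
  Cmp :: "'m \<Rightarrow> 'm \<Rightarrow> 'm"

locale category =
  fixes C :: "('o, 'm) precategory"
  assumes dom_cod: "f \<in> Ar C \<Longrightarrow> Dom C f \<in> Ob C \<and> Cod C f \<in> Ob C"
    and ident: "a \<in> Ob C \<Longrightarrow> Idn C a \<in> Ar C \<and> Dom C (Idn C a) = a \<and> Cod C (Idn C a) = a"
    and comp: "\<lbrakk>f \<in> Ar C; g \<in> Ar C; Cod C f = Dom C g\<rbrakk> \<Longrightarrow>
      Cmp C f g \<in> Ar C \<and> Dom C (Cmp C f g) = Dom C f \<and> Cod C (Cmp C f g) = Cod C g"
    and unit_left: "f \<in> Ar C \<Longrightarrow> Cmp C (Idn C (Dom C f)) f = f"
    and unit_right: "f \<in> Ar C \<Longrightarrow> Cmp C f (Idn C (Cod C f)) = f"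
    and assoc: "\<lbrakk>f \<in> Ar C; g \<in> Ar C; h \<in> Ar C; Cod C f = Dom C g; Cod C g = Dom C h\<rbrakk> \<Longrightarrow>
      Cmp C (Cmp C f g) h = Cmp C f (Cmp C g h)"

text \<open>A wide subcategory has all objects, so it is given by its set of arrows.\<close>

definition wide_subcategory :: "('o, 'm) precategory \<Rightarrow> 'm set \<Rightarrow> bool" where
  "wide_subcategory C S \<longleftrightarrow>
     S \<subseteq> Ar C \<and> (\<forall>a\<in>Ob C. Idn C a \<in> S) \<and>
     (\<forall>f\<in>S. \<forall>g\<in>S. Cod C f = Dom C g \<longrightarrow> Cmp C f g \<in> S)"

definition is_functor ::
    "('o, 'm) precategory \<Rightarrow> ('p, 'n) precategory \<Rightarrow> ('o \<Rightarrow> 'p) \<times> ('m \<Rightarrow> 'n) \<Rightarrow> bool" where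
  "is_functor C D = (\<lambda>(Fo, Fa).
     category C \<and> category D \<and>
     (\<forall>a\<in>Ob C. Fo a \<in> Ob D) \<and>
     (\<forall>f\<in>Ar C. Fa f \<in> Ar D \<and> Dom D (Fa f) = Fo (Dom C f) \<and> Cod D (Fa f) = Fo (Cod C f)) \<and>
     (\<forall>a\<in>Ob C. Fa (Idn C a) = Idn D (Fo a)) \<and>
     (\<forall>f\<in>Ar C. \<forall>g\<in>Ar C. Cod C f = Dom C g \<longrightarrow> Fa (Cmp C f g) = Cmp D (Fa f) (Fa g)))"

definition resource_theory :: "('o, 'm) precategory \<times> 'm set \<Rightarrow> bool" where
  "resource_theory = (\<lambda>(C, Cf). category C \<and> wide_subcategory C Cf)"

definition resource_functor ::
    "('o, 'm) precategory \<times> 'm set \<Rightarrow> ('p, 'n) precategory \<times> 'n set \<Rightarrow>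
     ('o \<Rightarrow> 'p) \<times> ('m \<Rightarrow> 'n) \<Rightarrow> bool" where
  "resource_functor = (\<lambda>(C, Cf) (D, Df) F.
     resource_theory (C, Cf) \<and> resource_theory (D, Df) \<and>
     is_functor C D F \<and> snd F ` Cf \<subseteq> Df)"

definition resource_reflecting ::
    "('o, 'm) precategory \<times> 'm set \<Rightarrow> ('p, 'n) precategory \<times> 'n set \<Rightarrow>
     ('o \<Rightarrow> 'p) \<times> ('m \<Rightarrow> 'n) \<Rightarrow> bool" where
  "resource_reflecting = (\<lambda>(C, Cf) (D, Df) F. \<forall>f\<in>Ar C. snd F f \<in> Df \<longrightarrow> f \<in> Cf)"


section \<open>Computational and physical contexts\<close>

record 'a comp_context =
  carr :: "'a set"
  distr :: "'a \<Rightarrow> real"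

record 'a phy_context = "'a comp_context" +
  rel :: "('a \<times> 'a) set"

datatype ('c, 'a) transformation =
  Transformation (source: 'c) (matrix: "('a, 'a) matrix") (target: 'c)

definition comp_context :: "'a comp_context \<Rightarrow> bool" where
  "comp_context p \<longleftrightarrow> distribution (carr p) (distr p)"

definition comp_transformation :: "('a comp_context, 'a) transformation \<Rightarrow> bool" where
  "comp_transformation f \<longleftrightarrow>
     comp_context (source f) \<and> comp_context (target f) \<and>
     subdist_matrix (carr (source f)) (carr (target f)) (matrix f) \<and>
     distr (source f) \<bullet> matrix f = distr (target f)"

definition phy_context :: "'a phy_context \<Rightarrow> bool" where
  "phy_context p \<longleftrightarrow> equiv (carr p) (rel p) \<and> distribution (carr p) (distr p)"

definition phy_transformation :: "('a phy_context, 'a) transformation \<Rightarrow> bool" where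
  "phy_transformation f \<longleftrightarrow>
     phy_context (source f) \<and> phy_context (target f) \<and>
     partitioned (carr (source f)) (rel (source f)) (carr (target f)) (rel (target f)) (matrix f) \<and>
     distr (source f) \<bullet> matrix f = distr (target f) \<and>
     entropy (distr (source f)) = entropy (distr (target f))"

definition Comp :: "('a comp_context, ('a comp_context, 'a) transformation) precategory" where
  "Comp = \<lparr>Ob = Collect comp_context, Ar = Collect comp_transformation,
     Dom = source, Cod = target,
     Idn = (\<lambda>p. Transformation p (id_mat (carr p)) p),
     Cmp = (\<lambda>f g. Transformation (source f) (matrix f \<cdot> matrix g) (target g))\<rparr>"

definition Phy :: "('a phy_context, ('a phy_context, 'a) transformation) precategory" where
  "Phy = \<lparr>Ob = Collect phy_context, Ar = Collect phy_transformation,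
     Dom = source, Cod = target,
     Idn = (\<lambda>p. Transformation p (id_mat (carr p)) p),
     Cmp = (\<lambda>f g. Transformation (source f) (matrix f \<cdot> matrix g) (target g))\<rparr>"

definition Q_ob :: "'a phy_context \<Rightarrow> 'a set comp_context" where
  "Q_ob p = \<lparr>carr = carr p // rel p, distr = Q_dist (carr p) (rel p) (distr p)\<rparr>"

definition Q_ar ::
    "('a phy_context, 'a) transformation \<Rightarrow> ('a set comp_context, 'a set) transformation" where
  "Q_ar f = Transformation (Q_ob (source f))
     (Q_mat (carr (source f)) (rel (source f)) (carr (target f)) (rel (target f)) (matrix f))
     (Q_ob (target f))"

definition Q ::
    "('a phy_context \<Rightarrow> 'a set comp_context) \<times>
     (('a phy_context, 'a) transformation \<Rightarrow> ('a set comp_context, 'a set) transformation)" where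
  "Q = (Q_ob, Q_ar)"

definition H_phy :: "'a phy_context \<Rightarrow> real" where
  "H_phy p = entropy (distr p)"

definition H_comp :: "'a phy_context \<Rightarrow> real" where
  "H_comp p = entropy (distr (Q_ob p))"

definition H_nc :: "'a phy_context \<Rightarrow> real" where
  "H_nc p = H_phy p - H_comp p"

definition non_entropy_ejecting :: "('a phy_context, 'a) transformation \<Rightarrow> bool" where
  "non_entropy_ejecting f \<longleftrightarrow> H_nc (target f) \<le> H_nc (source f)"

definition det_transformation :: "('a comp_context, 'a) transformation \<Rightarrow> bool" where
  "det_transformation f \<longleftrightarrow> deterministic (carr (source f)) (carr (target f)) (matrix f)"

definition restrict_mat :: "('a, 'b) matrix \<Rightarrow> 'a set \<Rightarrow> ('a, 'b) matrix" where
  "restrict_mat M A = (\<lambda>x y. if x \<in> A then M x y else 0)"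

definition conditionally_reversible :: "('a comp_context, 'a) transformation \<Rightarrow> bool" where
  "conditionally_reversible f \<longleftrightarrow>
     det_transformation f \<and>
     supp (distr (source f)) \<subseteq> mat_supp (matrix f) \<and>
     (\<exists>N. partial_inverse (supp (distr (source f))) (carr (target f))
            (restrict_mat (matrix f) (supp (distr (source f)))) N)"

definition Phy_f :: "('a phy_context, 'a) transformation set" where
  "Phy_f = {f \<in> Ar Phy. non_entropy_ejecting f \<and> det_transformation (Q_ar f)}"

definition Comp_f :: "('a comp_context, 'a) transformation set" where
  "Comp_f = {f \<in> Ar Comp. conditionally_reversible f}"

end

theory Submission
  imports Defs
begin

text \<open>
  A deterministic computational transformation between distributions is, on the support of its
  source \<open>p\<close>, a function \<open>\<phi>\<close>, and its target is the pushforward \<open>\<phi>\<^sub>* p\<close>. Both conditional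
  reversibility and \<open>H(p) \<le> H(\<phi>\<^sub>* p)\<close> are equivalent to injectivity of \<open>\<phi>\<close> on the support, the
  latter because \<open>H(p) - H(\<phi>\<^sub>* p)\<close> is the sum of the non-negative terms
  \<open>p\<^sub>x (log (\<phi>\<^sub>* p)\<^sub>\<phi>\<^sub>(\<^sub>x\<^sub>) - log p\<^sub>x)\<close>. Since physical transformations preserve the physical entropy,
  not ejecting entropy is the same inequality for the aggregated distributions.
\<close>

section \<open>Finitely supported sums\<close>

lemma sum'_eq_sum_superset:
  assumes "finite S" "S \<subseteq> A" "\<And>x. x \<in> A - S \<Longrightarrow> f x = 0"
  shows "sum' f A = sum f S"
proof -
  have "sum' f A = sum' f S"
    using assms by (intro sum.mono_neutral_right') auto
  then show ?thesis
    using assms by (simp add: sum.eq_sum)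
qed

lemma sum'_UNIV_eq_sum:
  assumes "finite S" "\<And>x. x \<notin> S \<Longrightarrow> f x = 0"
  shows "sum' f UNIV = sum f S"
  using assms by (intro sum'_eq_sum_superset) auto

lemma sum'_single:
  assumes "\<And>x. x \<noteq> a \<Longrightarrow> f x = 0"
  shows "sum' f UNIV = f a"
  using sum'_UNIV_eq_sum[of "{a}" f] assms by auto

lemma sum'_eq_UNIV:
  assumes "\<And>x. x \<notin> X \<Longrightarrow> f x = 0"
  shows "sum' f X = sum' f UNIV"
  using assms by (intro sum.mono_neutral_left') auto


section \<open>Row vectors and matrices\<close>

text \<open>Treats a matrix as a family of row vectors, so that facts about \<open>\<cdot>\<close>
  are obtained row by row from facts about \<open>\<bullet>\<close>.\<close>

lemma mat_mult_row: "(M \<cdot> N) x = M x \<bullet> N"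
  by (simp add: mat_mult_def dist_mult_def)

text \<open>Single entries of a non-negative function with finite support are bounded by its total
  mass, which yields \<open>p x \<le> 1\<close>. The mass over \<open>X\<close> is the mass over the
  whole type because \<open>p\<close> vanishes outside \<open>X\<close>.\<close>

lemma subdistribution_iff:
  "subdistribution X p \<longleftrightarrow>
     supp p \<subseteq> X \<and> finite (supp p) \<and> (\<forall>x. 0 \<le> p x) \<and> sum' p UNIV \<le> 1"
proof -
  have le: "p x \<le> 1"
    if "finite (supp p)" "\<forall>x. 0 \<le> p x" "sum' p UNIV \<le> 1" for x
  proof (cases "x \<in> supp p")
    case True
    have "p x \<le> sum p (supp p)"
      using True that by (intro member_le_sum) auto
    also have "\<dots> = sum' p UNIV"
      using that by (intro sum'_UNIV_eq_sum[symmetric]) (auto simp: supp_def)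
    finally show ?thesis
      using that by simp
  qed (simp add: supp_def)
  have "sum' p X = sum' p UNIV" if "supp p \<subseteq> X"
    using that by (intro sum'_eq_UNIV) (auto simp: supp_def)
  then show ?thesis
    unfolding subdistribution_def using le by auto
qed

lemma distribution_iff: "distribution X p \<longleftrightarrow> subdistribution X p \<and> sum' p UNIV = 1"
proof -
  have "sum' p X = sum' p UNIV" if "supp p \<subseteq> X"
    using that by (intro sum'_eq_UNIV) (auto simp: supp_def)
  then show ?thesis
    unfolding distribution_def by (auto simp: subdistribution_iff)
qed

lemma subdistribution_zero: "subdistribution X (\<lambda>_. 0)"
  by (simp add: subdistribution_iff supp_def sum'_UNIV_eq_sum[of "{}"])

text \<open>The zero rows outside \<open>X\<close> are themselves subdistributions, so row facts
  become available at every index without a membership condition.\<close>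

lemma subdist_matrix_iff:
  "subdist_matrix X Y M \<longleftrightarrow> (\<forall>x. subdistribution Y (M x)) \<and> (\<forall>x. x \<notin> X \<longrightarrow> M x = (\<lambda>_. 0))"
  unfolding subdist_matrix_def using subdistribution_zero by metis

lemma dist_mult_eq_sum:
  assumes "finite S" "supp p \<subseteq> S"
  shows "(p \<bullet> M) y = (\<Sum>x\<in>S. p x * M x y)"
  unfolding dist_mult_def
  using assms by (intro sum'_UNIV_eq_sum) (auto simp: supp_def)

lemma supp_dist_mult: "supp (p \<bullet> M) \<subseteq> (\<Union>x\<in>supp p. supp (M x))"
proof
  fix y
  assume y: "y \<in> supp (p \<bullet> M)"
  show "y \<in> (\<Union>x\<in>supp p. supp (M x))"
  proof (rule ccontr)
    assume "y \<notin> (\<Union>x\<in>supp p. supp (M x))"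
    then have "p x * M x y = 0" for x
      by (auto simp: supp_def)
    then have "(p \<bullet> M) y = 0"
      unfolding dist_mult_def by (simp add: sum'_UNIV_eq_sum[of "{}"])
    with y show False
      by (simp add: supp_def)
  qed
qed

lemma dist_mult_assoc:
  assumes p: "finite (supp p)" and M: "\<And>x. finite (supp (M x))"
  shows "(p \<bullet> M) \<bullet> N = p \<bullet> (M \<cdot> N)"
proof
  fix z
  \<comment> \<open>One finite set contains the supports of all rows that \<open>p\<close> weights.
    Every inner sum can run over it, and the two finite sums can be exchanged.\<close>
  define T where "T = (\<Union>x\<in>supp p. supp (M x))"
  have T: "finite T"
    using p M by (simp add: T_def)
  have "((p \<bullet> M) \<bullet> N) z = (\<Sum>y\<in>T. (p \<bullet> M) y * N y z)"
    using T supp_dist_mult[of p M] by (intro dist_mult_eq_sum) (simp_all add: T_def)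
  also have "\<dots> = (\<Sum>y\<in>T. \<Sum>x\<in>supp p. p x * (M x y * N y z))"
    by (simp add: dist_mult_eq_sum[OF p] sum_distrib_right mult.assoc)
  also have "\<dots> = (\<Sum>x\<in>supp p. \<Sum>y\<in>T. p x * (M x y * N y z))"
    by (rule sum.swap)
  also have "\<dots> = (\<Sum>x\<in>supp p. p x * (M \<cdot> N) x z)"
  proof (intro sum.cong refl)
    fix x
    assume "x \<in> supp p"
    then have "(M \<cdot> N) x z = (\<Sum>y\<in>T. M x y * N y z)"
      unfolding mat_mult_row using T by (intro dist_mult_eq_sum) (auto simp: T_def)
    then show "(\<Sum>y\<in>T. p x * (M x y * N y z)) = p x * (M \<cdot> N) x z"
      by (simp add: sum_distrib_left)
  qed
  also have "\<dots> = (p \<bullet> (M \<cdot> N)) z"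
    by (rule dist_mult_eq_sum[symmetric, OF p]) simp
  finally show "((p \<bullet> M) \<bullet> N) z = (p \<bullet> (M \<cdot> N)) z" .
qed

lemma subdist_mult_assoc:
  assumes "subdistribution X p" "subdist_matrix X' Y M"
  shows "(p \<bullet> M) \<bullet> N = p \<bullet> (M \<cdot> N)"
  using assms by (intro dist_mult_assoc) (auto simp: subdist_matrix_iff subdistribution_iff)

lemma mat_mult_assoc:
  assumes "subdist_matrix X Y M" "subdist_matrix Y Z N"
  shows "(M \<cdot> N) \<cdot> K = M \<cdot> (N \<cdot> K)"
  using assms
  by (auto simp: mat_mult_row subdist_matrix_iff intro!: ext fun_cong[OF subdist_mult_assoc])

lemma sum'_dist_mult:
  assumes p: "finite (supp p)" and M: "\<And>x. finite (supp (M x))"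
  shows "sum' (p \<bullet> M) UNIV = (\<Sum>x\<in>supp p. p x * sum' (M x) UNIV)"
proof -
  \<comment> \<open>The all-ones column turns total mass into a matrix product, so the claim becomes
    an instance of associativity.\<close>
  define E :: "'b \<Rightarrow> unit \<Rightarrow> real" where "E = (\<lambda>_ _. 1)"
  have E: "(q \<bullet> E) () = sum' q UNIV" for q
    by (simp add: dist_mult_def E_def)
  have "sum' (p \<bullet> M) UNIV = (p \<bullet> (M \<cdot> E)) ()"
    by (simp add: dist_mult_assoc[OF assms, symmetric] E)
  then show ?thesis
    by (simp add: dist_mult_eq_sum[OF p] mat_mult_row E)
qed

lemma subdistribution_sum_supp:
  assumes "subdistribution X p"
  shows "sum p (supp p) = sum' p UNIV"
  using assms
  by (intro sum'_UNIV_eq_sum[symmetric]) (auto simp: subdistribution_iff supp_def)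

lemma subdistribution_dist_mult:
  assumes p: "subdistribution X p" and M: "subdist_matrix X Y M"
  shows "subdistribution Y (p \<bullet> M)"
proof -
  have fin: "finite (supp p)" "finite (supp (M x))" for x
    using p M by (auto simp: subdistribution_iff subdist_matrix_iff)
  have nonneg: "0 \<le> p x" "0 \<le> M x y" for x y
    using p M by (auto simp: subdistribution_iff subdist_matrix_iff)
  have "supp (p \<bullet> M) \<subseteq> Y"
    using supp_dist_mult[of p M] M by (fastforce simp: subdistribution_iff subdist_matrix_iff)
  moreover have "finite (supp (p \<bullet> M))"
    using supp_dist_mult by (rule finite_subset) (use fin in auto)
  moreover have "0 \<le> (p \<bullet> M) y" for y
    using nonneg by (simp add: dist_mult_eq_sum[OF fin(1)] sum_nonneg)
  moreover have "sum' (p \<bullet> M) UNIV \<le> 1"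
  proof -
    have "sum' (p \<bullet> M) UNIV = (\<Sum>x\<in>supp p. p x * sum' (M x) UNIV)"
      using fin by (rule sum'_dist_mult)
    also have "\<dots> \<le> (\<Sum>x\<in>supp p. p x)"
      using M nonneg
      by (intro sum_mono mult_left_le) (auto simp: subdistribution_iff subdist_matrix_iff)
    also have "\<dots> \<le> 1"
      using subdistribution_sum_supp[OF p] p by (simp add: subdistribution_iff)
    finally show ?thesis .
  qed
  ultimately show ?thesis
    by (simp add: subdistribution_iff)
qed

lemma zero_dist_mult: "(\<lambda>_. 0) \<bullet> M = (\<lambda>_. 0)"
  by (simp add: dist_mult_def sum'_UNIV_eq_sum[of "{}"])

lemma subdist_matrix_mult:
  assumes "subdist_matrix X Y M" "subdist_matrix Y Z N"
  shows "subdist_matrix X Z (M \<cdot> N)"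
  using assms subdistribution_dist_mult[where X = Y and Y = Z and M = N]
  by (simp add: subdist_matrix_iff[of X] mat_mult_row zero_dist_mult)

section \<open>Point masses and the identity matrix\<close>

definition dirac :: "'a \<Rightarrow> 'a \<Rightarrow> real" where
  "dirac a = (\<lambda>b. if b = a then 1 else 0)"

lemma supp_dirac: "supp (dirac a) = {a}"
  by (auto simp: supp_def dirac_def)

lemma sum'_dirac: "sum' (dirac a) UNIV = 1"
  using sum'_single[of a "dirac a"] by (simp add: dirac_def)

lemma subdistribution_dirac: "a \<in> X \<Longrightarrow> subdistribution X (dirac a)"
  by (simp add: subdistribution_iff supp_dirac sum'_dirac) (simp add: dirac_def)

lemma dirac_dist_mult: "dirac a \<bullet> M = M a"
  by (rule ext, subst dist_mult_eq_sum[of "{a}"]) (auto simp: supp_dirac, simp add: dirac_def)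

lemma dirac_neq_zero: "dirac a \<noteq> (\<lambda>_. 0)"
  by (auto simp: dirac_def fun_eq_iff)

lemma dirac_eq_iff: "dirac a = dirac b \<longleftrightarrow> a = b"
  by (metis dirac_def zero_neq_one)

lemma id_mat_row: "id_mat X x = (if x \<in> X then dirac x else (\<lambda>_. 0))"
  by (auto simp: id_mat_def dirac_def fun_eq_iff)

lemma subdist_matrix_id: "subdist_matrix X X (id_mat X)"
  by (auto simp: subdist_matrix_def id_mat_row subdistribution_dirac)

lemma dist_mult_id:
  assumes "supp p \<subseteq> X"
  shows "p \<bullet> id_mat X = p"
proof
  fix y
  have "(p \<bullet> id_mat X) y = p y * id_mat X y y"
    unfolding dist_mult_def by (rule sum'_single) (simp add: id_mat_def)
  then show "(p \<bullet> id_mat X) y = p y"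
    using assms by (auto simp: id_mat_def supp_def)
qed

lemma mat_mult_id_right: "subdist_matrix X Y M \<Longrightarrow> M \<cdot> id_mat Y = M"
  by (rule ext) (auto simp: mat_mult_row subdist_matrix_iff subdistribution_iff dist_mult_id)

lemma mat_mult_id_left: "subdist_matrix X Y M \<Longrightarrow> id_mat X \<cdot> M = M"
  by (rule ext) (auto simp: mat_mult_row subdist_matrix_iff id_mat_row dirac_dist_mult zero_dist_mult)


section \<open>Deterministic matrices and partial inverses\<close>

lemma copy_mat_row: "copy_mat X x = (if x \<in> X then dirac (x, x) else (\<lambda>_. 0))"
  by (auto simp: copy_mat_def dirac_def fun_eq_iff)

text \<open>Comparing entries at \<open>(x, (y, z))\<close> gives \<open>M x y * M x z = 0\<close>
  for \<open>y \<noteq> z\<close> and \<open>M x y * M x y = M x y\<close>. A row therefore has at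
  most one non-zero entry, and that entry is \<open>1\<close>: deterministic matrices are partial
  functions.\<close>

lemma deterministic_iff:
  "deterministic X Y M \<longleftrightarrow>
     subdist_matrix X Y M \<and> (\<forall>x. M x = (\<lambda>_. 0) \<or> (\<exists>y. M x = dirac y))"
proof (cases "subdist_matrix X Y M")
  case True
  have l: "(copy_mat X \<cdot> (M \<otimes> M)) x (y, z) = M x y * M x z" for x y z
    using True
    by (simp add: mat_mult_row copy_mat_row dirac_dist_mult zero_dist_mult kronecker_def
        subdist_matrix_iff)
  have r: "(M \<cdot> copy_mat Y) x (y, z) = (if y = z then M x y else 0)" for x y z
  proof -
    have "(M \<cdot> copy_mat Y) x (y, z) = M x y * copy_mat Y y (y, z)"
      unfolding mat_mult_def by (rule sum'_single) (auto simp: copy_mat_def)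
    moreover have "M x y = 0" if "y \<notin> Y"
      using True that by (auto simp: subdist_matrix_iff subdistribution_iff supp_def)
    ultimately show ?thesis
      by (auto simp: copy_mat_def)
  qed
  have "deterministic X Y M \<longleftrightarrow> (\<forall>x y z. M x y * M x z = (if y = z then M x y else 0))"
    unfolding deterministic_def using True by (simp add: fun_eq_iff l r split_paired_all)
  also have "\<dots> \<longleftrightarrow> (\<forall>x. M x = (\<lambda>_. 0) \<or> (\<exists>y. M x = dirac y))"
  proof (intro iff_allI iffI)
    fix x
    assume *: "\<forall>y z. M x y * M x z = (if y = z then M x y else 0)"
    show "M x = (\<lambda>_. 0) \<or> (\<exists>y. M x = dirac y)"
    proof (cases "\<exists>y. M x y \<noteq> 0")
      case True
      then obtain y where y: "M x y \<noteq> 0" ..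
      have "M x z = dirac y z" for z
        using *[rule_format, of y z] y by (auto simp: dirac_def)
      then show ?thesis
        by blast
    qed auto
  next
    fix x
    assume "M x = (\<lambda>_. 0) \<or> (\<exists>y. M x = dirac y)"
    then show "\<forall>y z. M x y * M x z = (if y = z then M x y else 0)"
      by (auto simp: dirac_def)
  qed
  finally show ?thesis
    using True by simp
qed (simp add: deterministic_def)

lemma deterministic_id: "deterministic X X (id_mat X)"
  by (auto simp: deterministic_iff subdist_matrix_id id_mat_row)

lemma deterministic_mult:
  assumes "deterministic X Y M" "deterministic Y Z N"
  shows "deterministic X Z (M \<cdot> N)"
  unfolding deterministic_iff
proof (intro conjI allI)
  show "subdist_matrix X Z (M \<cdot> N)"
    using assms by (auto simp: deterministic_iff intro: subdist_matrix_mult)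
  fix x
  show "(M \<cdot> N) x = (\<lambda>_. 0) \<or> (\<exists>y. (M \<cdot> N) x = dirac y)"
    using assms unfolding deterministic_iff mat_mult_row
    by (metis dirac_dist_mult zero_dist_mult)
qed

text \<open>Copying \<open>x\<close>, keeping one copy and discarding the image of the other leaves
  \<open>x\<close> weighted by the mass of its row. The outcome is a diagonal matrix of row
  masses.\<close>

lemma domain_of_definition_eq:
  assumes "\<And>x. supp (M x) \<subseteq> Y" "\<And>x. x \<notin> X \<Longrightarrow> M x = (\<lambda>_. 0)"
  shows "domain_of_definition X Y M x = (\<lambda>x'. if x' = x then sum' (M x) UNIV else 0)"
proof -
  have "(M \<cdot> discard_mat Y) x () = sum' (M x) UNIV"
  proof -
    have "M x y * discard_mat Y y () = M x y" for y
      using assms(1)[of x] by (auto simp: discard_mat_def supp_def)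
    then show ?thesis
      unfolding mat_mult_def by presburger
  qed
  then show ?thesis
    using assms(2)[of x]
    by (auto simp: domain_of_definition_def mat_mult_row[of "copy_mat X"] copy_mat_row
        dirac_dist_mult zero_dist_mult kronecker_def id_mat_def fun_eq_iff
        sum'_UNIV_eq_sum[of "{}"])
qed

text \<open>Here \<open>M\<close> is the matrix of a function that is total on \<open>S\<close>. A
  partial inverse has to send \<open>\<phi> x\<close> back to \<open>x\<close>, which is possible
  exactly if \<open>\<phi> x\<close> determines \<open>x\<close>.\<close>

lemma partial_inverse_function_iff:
  fixes \<phi> :: "'a \<Rightarrow> 'b"
  assumes \<phi>: "\<phi> ` S \<subseteq> Y"
    and M: "\<And>x. M x = (if x \<in> S then dirac (\<phi> x) else (\<lambda>_. 0))"
  shows "(\<exists>N. partial_inverse S Y M N) \<longleftrightarrow> inj_on \<phi> S"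
proof
  \<comment> \<open>Every row indexed by \<open>S\<close> is a point mass and so has mass
    one.\<close>
  have "domain_of_definition S Y M = id_mat S"
  proof
    fix x
    have "domain_of_definition S Y M x = (\<lambda>x'. if x' = x then sum' (M x) UNIV else 0)"
      using \<phi> by (intro domain_of_definition_eq) (auto simp: M supp_dirac, simp add: supp_def)
    then show "domain_of_definition S Y M x = id_mat S x"
      by (auto simp: M sum'_dirac id_mat_def sum'_UNIV_eq_sum[of "{}"])
  qed
  note dom = this
  {
    assume "\<exists>N. partial_inverse S Y M N"
    then obtain N where "M \<cdot> N = id_mat S"
      by (auto simp: partial_inverse_def dom)
    then have "M x \<bullet> N = id_mat S x" for x
      by (simp flip: mat_mult_row)
    \<comment> \<open>The row of \<open>N\<close> at \<open>\<phi> x\<close> recovers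
      \<open>x\<close>, because distinct points have distinct point masses.\<close>
    then have "N (\<phi> x) = dirac x" if "x \<in> S" for x
      using that by (metis M dirac_dist_mult id_mat_row)
    then show "inj_on \<phi> S"
      by (metis dirac_eq_iff inj_onI)
  next
    assume inj: "inj_on \<phi> S"
    \<comment> \<open>The witness is the inverse function on the image of \<open>\<phi>\<close>. On
      the rest of \<open>Y\<close> its rows are zero, so it is in general only a partial
      function.\<close>
    define N where
      "N = (\<lambda>y. if y \<in> \<phi> ` S then dirac (the_inv_into S \<phi> y) else (\<lambda>_. 0))"
    have inv: "the_inv_into S \<phi> (\<phi> x) = x" if "x \<in> S" for x
      using inj that by (rule the_inv_into_f_f)
    have N\<phi>: "N (\<phi> x) = dirac x" if "x \<in> S" for x
      using that by (simp add: N_def inv)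
    have N0: "N y = (\<lambda>_. 0)" if "y \<notin> \<phi> ` S" for y
      using that by (simp add: N_def)
    have sub: "subdist_matrix Y S N"
      unfolding subdist_matrix_def
    proof (intro conjI ballI allI impI)
      fix y
      show "subdistribution S (N y)"
        by (cases "y \<in> \<phi> ` S") (auto simp: N\<phi> N0 subdistribution_dirac subdistribution_zero)
    next
      fix y
      assume "y \<notin> Y"
      then show "N y = (\<lambda>y. 0)"
        using \<phi> by (intro N0) auto
    qed
    have MN: "M \<cdot> N = id_mat S"
      by (rule ext) (simp add: mat_mult_row M dirac_dist_mult zero_dist_mult N\<phi> id_mat_row)
    \<comment> \<open>At \<open>\<phi> x\<close> both rows are the point mass there, since going
      back to \<open>x\<close> and forth again returns to it. Off the image both rows are
      zero.\<close>
    have NM: "N \<cdot> M = domain_of_definition Y S N"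
    proof
      fix y
      have "domain_of_definition Y S N y = (\<lambda>y'. if y' = y then sum' (N y) UNIV else 0)"
        using sub
        by (intro domain_of_definition_eq) (auto simp: subdist_matrix_iff subdistribution_iff)
      also have "\<dots> = N y \<bullet> M"
        by (cases "y \<in> \<phi> ` S")
          (auto simp: N\<phi> N0 sum'_dirac dirac_dist_mult zero_dist_mult M
            sum'_UNIV_eq_sum[of "{}"] dirac_def[of "\<phi> _"] fun_eq_iff)
      finally show "(N \<cdot> M) y = domain_of_definition Y S N y"
        by (simp add: mat_mult_row)
    qed
    show "\<exists>N. partial_inverse S Y M N"
      using sub MN NM by (auto simp: partial_inverse_def dom)
  }
qed


text \<open>Merging points into fibres only increases weights,
  \<open>p x \<le> q (\<phi> x)\<close>, so entropy cannot grow. The stated inequality then forces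
  equality in every term, that is, each fibre meets the support in at most one point.\<close>

lemma entropy_pushforward_le_iff:
  fixes p :: "'a \<Rightarrow> real" and q :: "'b \<Rightarrow> real"
  assumes fin: "finite (supp p)" and nonneg: "\<And>x. 0 \<le> p x"
    and q: "\<And>y. q y = (\<Sum>x\<in>{x \<in> supp p. \<phi> x = y}. p x)"
  shows "entropy p \<le> entropy q \<longleftrightarrow> inj_on \<phi> (supp p)"
proof -
  let ?S = "supp p"
  have pos: "0 < p x" if "x \<in> ?S" for x
    using that nonneg[of x] by (simp add: supp_def)
  have le: "p x \<le> q (\<phi> x)" if "x \<in> ?S" for x
    unfolding q using that fin nonneg by (intro member_le_sum) auto
  have Hp: "entropy p = - (\<Sum>x\<in>?S. p x * ln (p x))"
    unfolding entropy_def
    using fin by (subst sum'_UNIV_eq_sum[of ?S]) (auto simp: supp_def)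
  have "q y = 0" if "y \<notin> \<phi> ` ?S" for y
    unfolding q using that by (intro sum.neutral) auto
  then have "entropy q = - (\<Sum>y\<in>\<phi> ` ?S. q y * ln (q y))"
    unfolding entropy_def using fin by (subst sum'_UNIV_eq_sum[of "\<phi> ` ?S"]) auto
  \<comment> \<open>Within the fibre over \<open>y\<close> the factor \<open>q y\<close> is expanded
    as a sum of weights \<open>p x\<close>, while the logarithm is common to the fibre. The fibres
    then reassemble into the support.\<close>
  also have "(\<Sum>y\<in>\<phi> ` ?S. q y * ln (q y)) =
      (\<Sum>y\<in>\<phi> ` ?S. \<Sum>x\<in>{x \<in> ?S. \<phi> x = y}. p x * ln (q (\<phi> x)))"
    by (intro sum.cong refl) (simp add: q sum_distrib_right)
  also have "\<dots> = (\<Sum>x\<in>?S. p x * ln (q (\<phi> x)))"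
    using fin by (rule sum.image_gen[symmetric])
  finally have "entropy p - entropy q = (\<Sum>x\<in>?S. p x * (ln (q (\<phi> x)) - ln (p x)))"
    by (simp add: Hp right_diff_distrib sum_subtractf)
  moreover have term_nonneg: "0 \<le> p x * (ln (q (\<phi> x)) - ln (p x))" if "x \<in> ?S" for x
    using le[OF that] pos[OF that] by simp
  then have "0 \<le> (\<Sum>x\<in>?S. p x * (ln (q (\<phi> x)) - ln (p x)))"
    by (rule sum_nonneg)
  ultimately have "entropy p \<le> entropy q \<longleftrightarrow> (\<Sum>x\<in>?S. p x * (ln (q (\<phi> x)) - ln (p x))) = 0"
    by linarith
  also have "\<dots> \<longleftrightarrow> (\<forall>x\<in>?S. p x * (ln (q (\<phi> x)) - ln (p x)) = 0)"
    using fin term_nonneg by (rule sum_nonneg_eq_0_iff)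
  \<comment> \<open>On the support \<open>p x\<close> is positive, and the logarithm is injective on
    positive numbers.\<close>
  also have "\<dots> \<longleftrightarrow> (\<forall>x\<in>?S. q (\<phi> x) = p x)"
  proof (intro ball_cong refl)
    fix x
    assume "x \<in> ?S"
    then show "p x * (ln (q (\<phi> x)) - ln (p x)) = 0 \<longleftrightarrow> q (\<phi> x) = p x"
      using le[of x] pos[of x] by auto
  qed
  also have "\<dots> \<longleftrightarrow> inj_on \<phi> ?S"
  proof
    assume *: "\<forall>x\<in>?S. q (\<phi> x) = p x"
    show "inj_on \<phi> ?S"
    proof (rule inj_onI, rule ccontr)
      fix x x'
      assume x: "x \<in> ?S" "x' \<in> ?S" "\<phi> x = \<phi> x'" "x \<noteq> x'"
      \<comment> \<open>Two support points in one fibre would make \<open>q (\<phi> x)\<close>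
        exceed \<open>p x\<close> by at least \<open>p x' > 0\<close>.\<close>
      have "p x + p x' = sum p {x, x'}"
        using x by simp
      also have "\<dots> \<le> q (\<phi> x)"
        unfolding q using x fin nonneg by (intro sum_mono2) auto
      finally show False
        using * x pos[of x] pos[of x'] by auto
    qed
  next
    assume inj: "inj_on \<phi> ?S"
    show "\<forall>x\<in>?S. q (\<phi> x) = p x"
    proof
      fix x
      assume "x \<in> ?S"
      then have "{x' \<in> ?S. \<phi> x' = \<phi> x} = {x}"
        using inj by (auto dest: inj_onD)
      then show "q (\<phi> x) = p x"
        by (simp add: q)
    qed
  qed
  finally show ?thesis .
qed

text \<open>A deterministic matrix is only a partial function, but since source and target both have
  mass one, no mass is lost and the function is defined on the whole support of the source. Both
  sides then reduce to its injectivity there.\<close>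

lemma conditionally_reversible_iff_entropy:
  assumes f: "comp_transformation f"
  shows "conditionally_reversible f \<longleftrightarrow>
    det_transformation f \<and> entropy (distr (source f)) \<le> entropy (distr (target f))"
proof (cases "det_transformation f")
  case True
  let ?M = "matrix f" and ?p = "distr (source f)" and ?q = "distr (target f)"
  let ?X = "carr (source f)" and ?Y = "carr (target f)" and ?S = "supp (distr (source f))"
  have M: "subdist_matrix ?X ?Y ?M" and pM: "?p \<bullet> ?M = ?q"
    and p: "subdistribution ?X ?p" "sum' ?p UNIV = 1" and q: "sum' ?q UNIV = 1"
    using f by (auto simp: comp_transformation_def comp_context_def distribution_iff)
  have fin: "finite ?S" "finite (supp (?M x))" and nonneg: "0 \<le> ?p x"
    and row_le: "sum' (?M x) UNIV \<le> 1" for x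
    using p M by (auto simp: subdist_matrix_iff subdistribution_iff)
  \<comment> \<open>The deficits \<open>1 - sum' (?M x) UNIV\<close>, weighted by \<open>?p\<close>,
    are non-negative and add up to the mass lost, which is zero. Each deficit with positive weight
    is thus zero.\<close>
  have row: "sum' (?M x) UNIV = 1" if "x \<in> ?S" for x
  proof -
    have "(\<Sum>x\<in>?S. ?p x * (1 - sum' (?M x) UNIV)) = 0"
      using sum'_dist_mult[of ?p ?M, OF fin] q p
      by (simp add: pM right_diff_distrib sum_subtractf subdistribution_sum_supp[OF p(1)])
    then have "?p x * (1 - sum' (?M x) UNIV) = 0"
      using that fin nonneg row_le by (subst (asm) sum_nonneg_eq_0_iff) auto
    then show ?thesis
      using that by (simp add: supp_def)
  qed
  have "\<exists>y. ?M x = dirac y" if "x \<in> ?S" for x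
  proof -
    have "?M x \<noteq> (\<lambda>_. 0)"
      using row[OF that] by (auto simp: sum'_UNIV_eq_sum[of "{}"])
    then show ?thesis
      using True by (auto simp: det_transformation_def deterministic_iff)
  qed
  then obtain \<phi> where \<phi>: "?M x = dirac (\<phi> x)" if "x \<in> ?S" for x
    by metis
  have \<phi>Y: "\<phi> ` ?S \<subseteq> ?Y"
  proof
    fix y
    assume "y \<in> \<phi> ` ?S"
    then obtain x where "x \<in> ?S" "y = \<phi> x"
      by blast
    then have "y \<in> supp (?M x)"
      by (simp add: \<phi> supp_dirac)
    then show "y \<in> ?Y"
      using M by (auto simp: subdist_matrix_iff subdistribution_iff)
  qed
  have "?S \<subseteq> mat_supp ?M"
    using dirac_neq_zero by (fastforce simp: mat_supp_def \<phi> fun_eq_iff)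
  moreover have "(\<exists>N. partial_inverse ?S ?Y (restrict_mat ?M ?S) N) \<longleftrightarrow> inj_on \<phi> ?S"
    using \<phi>Y by (rule partial_inverse_function_iff) (auto simp: restrict_mat_def \<phi>)
  moreover have "entropy ?p \<le> entropy ?q \<longleftrightarrow> inj_on \<phi> ?S"
  proof (rule entropy_pushforward_le_iff[OF fin(1) nonneg])
    fix y
    have "?q y = (\<Sum>x\<in>?S. ?p x * ?M x y)"
      using dist_mult_eq_sum[OF fin(1) order.refl] pM by metis
    also have "\<dots> = (\<Sum>x\<in>?S. if \<phi> x = y then ?p x else 0)"
      by (intro sum.cong) (auto simp: \<phi> dirac_def)
    also have "\<dots> = (\<Sum>x\<in>{x \<in> ?S. \<phi> x = y}. ?p x)"
      using fin(1) by (rule sum.inter_filter[symmetric])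
    finally show "?q y = (\<Sum>x\<in>{x \<in> ?S. \<phi> x = y}. ?p x)" .
  qed
  ultimately show ?thesis
    using True by (simp add: conditionally_reversible_def)
qed (simp add: conditionally_reversible_def)


section \<open>Aggregation\<close>

text \<open>Aggregation is multiplication by the matrix that sends each point to its class, so that
  functoriality reduces to associativity of matrix multiplication.\<close>

definition class_mat :: "'a set \<Rightarrow> ('a \<times> 'a) set \<Rightarrow> ('a, 'a set) matrix" where
  "class_mat X r = (\<lambda>x. if x \<in> X then dirac (r `` {x}) else (\<lambda>_. 0))"

lemma subdist_matrix_class_mat: "subdist_matrix X (X // r) (class_mat X r)"
  by (auto simp: subdist_matrix_def class_mat_def intro: subdistribution_dirac quotientI)

lemma Q_dist_eq_mult:
  assumes r: "equiv X r"
  shows "Q_dist X r p = p \<bullet> class_mat X r"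
proof
  fix C
  show "Q_dist X r p C = (p \<bullet> class_mat X r) C"
  proof (cases "C \<in> X // r")
    case True
    \<comment> \<open>The column at a class is the indicator function of that class, so multiplying
      by it collects the mass of the class.\<close>
    have *: "class_mat X r x C = (if x \<in> C then 1 else 0)" for x
    proof -
      obtain a where a: "a \<in> X" "C = r `` {a}"
        using True by (rule quotientE)
      have "x \<in> C \<longleftrightarrow> x \<in> X \<and> r `` {x} = C"
        using a r eq_equiv_class_iff[OF r] equiv_type[OF r] by blast
      then show ?thesis
        by (auto simp: class_mat_def dirac_def)
    qed
    have "sum' p C = sum' (\<lambda>x. p x * class_mat X r x C) C"
      by (rule sum.cong') (auto simp: *)
    also have "\<dots> = sum' (\<lambda>x. p x * class_mat X r x C) UNIV"
      by (rule sum'_eq_UNIV) (simp add: *)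
    finally show ?thesis
      using True by (simp add: Q_dist_def dist_mult_def)
  next
    case False
    then have "class_mat X r x C = 0" for x
      by (auto simp: class_mat_def dirac_def quotientI)
    then show ?thesis
      using False by (simp add: Q_dist_def dist_mult_def sum'_UNIV_eq_sum[of "{}"])
  qed
qed

lemma distribution_Q_dist:
  assumes r: "equiv X r" and p: "distribution X p"
  shows "distribution (X // r) (Q_dist X r p)"
proof -
  have sub: "subdistribution X p" and X: "supp p \<subseteq> X"
    using p by (auto simp: distribution_iff subdistribution_iff)
  have "sum' (p \<bullet> class_mat X r) UNIV = (\<Sum>x\<in>supp p. p x * sum' (class_mat X r x) UNIV)"
    using sub subdist_matrix_class_mat[of X r]
    by (intro sum'_dist_mult) (auto simp: subdistribution_iff subdist_matrix_iff)
  also have "\<dots> = (\<Sum>x\<in>supp p. p x)"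
    using X by (intro sum.cong) (auto simp: class_mat_def sum'_dirac)
  also have "\<dots> = 1"
    using p subdistribution_sum_supp[OF sub] by (simp add: distribution_iff)
  finally show ?thesis
    using subdistribution_dist_mult[OF sub subdist_matrix_class_mat]
    by (simp add: distribution_iff Q_dist_eq_mult[OF r])
qed

section \<open>Partitioned matrices and their aggregation\<close>

lemma partitioned_id:
  assumes "equiv X r"
  shows "partitioned X r X r (id_mat X)"
  using assms by (auto simp: partitioned_def subdist_matrix_id subdistribution_iff dist_mult_id)

lemma partitioned_mult:
  assumes M: "partitioned X r Y s M" and N: "partitioned Y s Z t N"
  shows "partitioned X r Z t (M \<cdot> N)"
proof -
  have sub: "subdist_matrix X Y M" "subdist_matrix Y Z N"
    using M N by (auto simp: partitioned_def)
  have "dist_equiv Z t (p \<bullet> (M \<cdot> N)) (q \<bullet> (M \<cdot> N))"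
    if "subdistribution X p" "subdistribution X q" "dist_equiv X r p q" for p q
  proof -
    have "dist_equiv Z t ((p \<bullet> M) \<bullet> N) ((q \<bullet> M) \<bullet> N)"
      using M N sub that subdistribution_dist_mult unfolding partitioned_def by metis
    then show ?thesis
      using that sub by (simp add: subdist_mult_assoc)
  qed
  then show ?thesis
    using sub by (auto simp: partitioned_def intro: subdist_matrix_mult)
qed

text \<open>Removes the representative chosen by \<open>SOME\<close> in \<open>Q_mat\<close>: by
  \<open>Q_mat_class\<close>, any \<open>x\<close> in the class may be used, and its row is
  aggregated.\<close>

lemma Q_mat_row:
  assumes X: "equiv X r" and Y: "equiv Y s" and M: "partitioned X r Y s M" and x: "x \<in> X"
  shows "Q_mat X r Y s M (r `` {x}) = M x \<bullet> class_mat Y s"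
proof -
  have "Q_mat X r Y s M (r `` {x}) D = Q_dist Y s (M x) D" for D
  proof (cases "D \<in> Y // s")
    case True
    then obtain y where "y \<in> Y" "D = s `` {y}"
      by (rule quotientE)
    then show ?thesis
      using Q_mat_class[OF X Y M x] True by (simp add: Q_dist_def)
  qed (simp add: Q_mat_def Q_dist_def)
  then show ?thesis
    by (simp add: Q_dist_eq_mult[OF Y, symmetric] fun_eq_iff)
qed

lemma Q_mat_row_outside: "C \<notin> X // r \<Longrightarrow> Q_mat X r Y s M C = (\<lambda>_. 0)"
  by (simp add: Q_mat_def)

text \<open>This is a naturality square for the class maps: aggregating and then applying the
  aggregated matrix agrees with applying the matrix and then aggregating. For \<open>x\<close>
  outside \<open>X\<close> both rows are zero.\<close>

lemma class_mat_mult_Q_mat: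
  assumes X: "equiv X r" and Y: "equiv Y s" and M: "partitioned X r Y s M"
  shows "class_mat X r \<cdot> Q_mat X r Y s M = M \<cdot> class_mat Y s"
proof
  fix x
  show "(class_mat X r \<cdot> Q_mat X r Y s M) x = (M \<cdot> class_mat Y s) x"
    using M Q_mat_row[OF assms, of x]
    by (auto simp: mat_mult_row class_mat_def[of X] dirac_dist_mult zero_dist_mult
        partitioned_def subdist_matrix_def)
qed

lemma subdist_matrix_Q_mat:
  assumes X: "equiv X r" and Y: "equiv Y s" and M: "partitioned X r Y s M"
  shows "subdist_matrix (X // r) (Y // s) (Q_mat X r Y s M)"
  unfolding subdist_matrix_def
proof (intro conjI ballI allI impI)
  fix C
  assume "C \<in> X // r"
  then obtain x where x: "x \<in> X" "C = r `` {x}"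
    by (rule quotientE)
  have "subdistribution Y (M x)"
    using M x by (simp add: partitioned_def subdist_matrix_def)
  then show "subdistribution (Y // s) (Q_mat X r Y s M C)"
    using Q_mat_row[OF assms x(1)] subdistribution_dist_mult[OF _ subdist_matrix_class_mat] x
    by simp
qed (rule Q_mat_row_outside)

text \<open>The naturality square, multiplied by \<open>p\<close> from the left. For a context
  \<open>p\<close> it shows that \<open>Q_mat\<close> carries the aggregated source to the
  aggregated target.\<close>

lemma Q_dist_mult_Q_mat:
  assumes X: "equiv X r" and Y: "equiv Y s" and M: "partitioned X r Y s M"
    and p: "subdistribution X p"
  shows "Q_dist X r p \<bullet> Q_mat X r Y s M = Q_dist Y s (p \<bullet> M)"
proof -
  have sub: "subdist_matrix X Y M"
    using M by (simp add: partitioned_def)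
  have "(p \<bullet> class_mat X r) \<bullet> Q_mat X r Y s M = p \<bullet> (M \<cdot> class_mat Y s)"
    using subdist_mult_assoc[OF p subdist_matrix_class_mat] class_mat_mult_Q_mat[OF X Y M]
    by metis
  also have "\<dots> = (p \<bullet> M) \<bullet> class_mat Y s"
    using subdist_mult_assoc[OF p sub] by metis
  finally show ?thesis
    by (simp add: Q_dist_eq_mult X Y)
qed

lemma Q_mat_id:
  assumes X: "equiv X r"
  shows "Q_mat X r X r (id_mat X) = id_mat (X // r)"
proof
  fix C
  show "Q_mat X r X r (id_mat X) C = id_mat (X // r) C"
  proof (cases "C \<in> X // r")
    case True
    then obtain x where x: "x \<in> X" "C = r `` {x}"
      by (rule quotientE)
    then show ?thesis
      using Q_mat_row[OF X X partitioned_id[OF X] x(1)] True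
      by (simp add: id_mat_row dirac_dist_mult class_mat_def)
  qed (simp add: Q_mat_row_outside id_mat_row)
qed

text \<open>At the class of \<open>x\<close>, both rows are the aggregate of
  \<open>M x \<bullet> N\<close>. The right-hand one is obtained from
  \<open>Q_dist_mult_Q_mat\<close>, applied to the row \<open>M x\<close> as a
  subdistribution.\<close>

lemma Q_mat_mult:
  assumes X: "equiv X r" and Y: "equiv Y s" and Z: "equiv Z t"
    and M: "partitioned X r Y s M" and N: "partitioned Y s Z t N"
  shows "Q_mat X r Z t (M \<cdot> N) = Q_mat X r Y s M \<cdot> Q_mat Y s Z t N"
proof
  fix C
  show "Q_mat X r Z t (M \<cdot> N) C = (Q_mat X r Y s M \<cdot> Q_mat Y s Z t N) C"
  proof (cases "C \<in> X // r")
    case True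
    then obtain x where x: "x \<in> X" "C = r `` {x}"
      by (rule quotientE)
    have Mx: "subdistribution Y (M x)"
      using M x by (simp add: partitioned_def subdist_matrix_def)
    have "Q_mat X r Z t (M \<cdot> N) C = Q_dist Z t (M x \<bullet> N)"
      using Q_mat_row[OF X Z partitioned_mult[OF M N] x(1)] x(2)
      by (simp add: mat_mult_row Q_dist_eq_mult[OF Z])
    also have "\<dots> = Q_dist Y s (M x) \<bullet> Q_mat Y s Z t N"
      by (rule Q_dist_mult_Q_mat[OF Y Z N Mx, symmetric])
    also have "\<dots> = (Q_mat X r Y s M \<cdot> Q_mat Y s Z t N) C"
      using Q_mat_row[OF X Y M x(1)] x(2) by (simp add: mat_mult_row Q_dist_eq_mult[OF Y])
    finally show ?thesis .
  qed (simp add: Q_mat_row_outside mat_mult_row zero_dist_mult)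
qed


section \<open>The resource theories\<close>

lemma Comp_simps:
  "Ob Comp = Collect comp_context" "Ar Comp = Collect comp_transformation"
  "Dom Comp = source" "Cod Comp = target"
  by (simp_all add: Comp_def)

lemma Phy_simps:
  "Ob Phy = Collect phy_context" "Ar Phy = Collect phy_transformation"
  "Dom Phy = source" "Cod Phy = target"
  by (simp_all add: Phy_def)

lemma Q_ar_simps: "source (Q_ar f) = Q_ob (source f)" "target (Q_ar f) = Q_ob (target f)"
  by (simp_all add: Q_ar_def)

lemma category_Comp: "category Comp"
proof
  fix f g :: "('a comp_context, 'a) transformation"
  assume "f \<in> Ar Comp" "g \<in> Ar Comp" "Cod Comp f = Dom Comp g"
  then have *: "comp_transformation f" "comp_transformation g" "target f = source g"
    by (auto simp: Comp_def)
  then have "subdist_matrix (carr (source f)) (carr (target g)) (matrix f \<cdot> matrix g)"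
    by (auto simp: comp_transformation_def intro: subdist_matrix_mult)
  moreover have "distr (source f) \<bullet> (matrix f \<cdot> matrix g) = distr (target g)"
    using * subdist_mult_assoc unfolding comp_transformation_def comp_context_def distribution_iff
    by metis
  ultimately show "Cmp Comp f g \<in> Ar Comp \<and> Dom Comp (Cmp Comp f g) = Dom Comp f \<and>
      Cod Comp (Cmp Comp f g) = Cod Comp g"
    using * by (simp add: Comp_def comp_transformation_def)
next
  fix a :: "'a comp_context"
  assume "a \<in> Ob Comp"
  then show "Idn Comp a \<in> Ar Comp \<and> Dom Comp (Idn Comp a) = a \<and> Cod Comp (Idn Comp a) = a"
    by (auto simp: Comp_def comp_transformation_def subdist_matrix_id comp_context_def
        distribution_iff subdistribution_iff intro!: dist_mult_id)
qed (auto simp: Comp_def comp_transformation_def mat_mult_id_left mat_mult_id_right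
    transformation.expand intro: mat_mult_assoc)

lemma phy_transformationD:
  assumes "phy_transformation f"
  shows "equiv (carr (source f)) (rel (source f))" "equiv (carr (target f)) (rel (target f))"
    "partitioned (carr (source f)) (rel (source f)) (carr (target f)) (rel (target f)) (matrix f)"
    "subdist_matrix (carr (source f)) (carr (target f)) (matrix f)"
    "subdistribution (carr (source f)) (distr (source f))"
    "distr (source f) \<bullet> matrix f = distr (target f)"
    "entropy (distr (source f)) = entropy (distr (target f))"
  using assms by (auto simp: phy_transformation_def phy_context_def partitioned_def distribution_iff)

lemma category_Phy: "category Phy"
proof
  fix f g :: "('a phy_context, 'a) transformation"
  assume "f \<in> Ar Phy" "g \<in> Ar Phy" "Cod Phy f = Dom Phy g"
  then have *: "phy_transformation f" "phy_transformation g" "target f = source g"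
    by (auto simp: Phy_def)
  then have "partitioned (carr (source f)) (rel (source f)) (carr (target g)) (rel (target g))
      (matrix f \<cdot> matrix g)"
    by (auto simp: phy_transformation_def intro: partitioned_mult)
  moreover have "distr (source f) \<bullet> (matrix f \<cdot> matrix g) = distr (target g)"
    using * phy_transformationD subdist_mult_assoc by metis
  ultimately show "Cmp Phy f g \<in> Ar Phy \<and> Dom Phy (Cmp Phy f g) = Dom Phy f \<and>
      Cod Phy (Cmp Phy f g) = Cod Phy g"
    using * by (simp add: Phy_def phy_transformation_def)
next
  fix a :: "'a phy_context"
  assume "a \<in> Ob Phy"
  then show "Idn Phy a \<in> Ar Phy \<and> Dom Phy (Idn Phy a) = a \<and> Cod Phy (Idn Phy a) = a"
    by (auto simp: Phy_def phy_transformation_def partitioned_id phy_context_def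
        distribution_iff subdistribution_iff intro!: dist_mult_id)
next
  fix f g h :: "('a phy_context, 'a) transformation"
  assume "f \<in> Ar Phy" "g \<in> Ar Phy" "h \<in> Ar Phy" "Cod Phy f = Dom Phy g" "Cod Phy g = Dom Phy h"
  then show "Cmp Phy (Cmp Phy f g) h = Cmp Phy f (Cmp Phy g h)"
    by (auto simp: Phy_def phy_transformation_def partitioned_def intro: mat_mult_assoc)
qed (auto simp: Phy_def phy_transformation_def partitioned_def mat_mult_id_left mat_mult_id_right
    transformation.expand)

lemma comp_context_Q_ob: "phy_context p \<Longrightarrow> comp_context (Q_ob p)"
  by (simp add: phy_context_def comp_context_def Q_ob_def distribution_Q_dist)

lemma comp_transformation_Q_ar:
  assumes "phy_transformation f"
  shows "comp_transformation (Q_ar f)"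
  using assms phy_transformationD[OF assms]
  \<comment> \<open>\<open>Q_ob\<close> stays folded at first so that
    \<open>comp_context_Q_ob\<close> applies; it is unfolded afterwards for the claims on the matrix
    and the pushed distribution.\<close>
  by (auto simp: comp_transformation_def Q_ar_def phy_transformation_def comp_context_Q_ob)
    (auto simp: Q_ob_def subdist_matrix_Q_mat Q_dist_mult_Q_mat)

lemma Q_ar_Idn: "phy_context a \<Longrightarrow> Q_ar (Idn Phy a) = Idn Comp (Q_ob a)"
  by (simp add: Q_ar_def Phy_def Comp_def phy_context_def Q_mat_id) (simp add: Q_ob_def)

lemma Q_ar_Cmp:
  assumes "phy_transformation f" "phy_transformation g" "target f = source g"
  shows "Q_ar (Cmp Phy f g) = Cmp Comp (Q_ar f) (Q_ar g)"
  using Q_mat_mult[of "carr (source f)" "rel (source f)" "carr (target f)" "rel (target f)"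
      "carr (target g)" "rel (target g)" "matrix f" "matrix g"]
    phy_transformationD[OF assms(1)] phy_transformationD[OF assms(2)] assms(3)
  by (simp add: Q_ar_def Phy_def Comp_def)

lemma is_functor_Q: "is_functor Phy Comp Q"
  unfolding is_functor_def Q_def prod.case
proof (intro conjI ballI impI)
  show "category Phy" "category Comp"
    by (rule category_Phy category_Comp)+
qed (auto simp: Phy_simps Comp_simps Q_ar_simps comp_context_Q_ob comp_transformation_Q_ar
    Q_ar_Idn Q_ar_Cmp)

text \<open>In this form closure under composition needs no composite of partial inverses:
  deterministic matrices compose, and the entropy inequality is transitive.\<close>

lemma Comp_f_iff:
  "f \<in> Comp_f \<longleftrightarrow> comp_transformation f \<and> det_transformation f \<and>
     entropy (distr (source f)) \<le> entropy (distr (target f))"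
  by (auto simp: Comp_f_def Comp_def conditionally_reversible_iff_entropy)

text \<open>The physical entropies of source and target agree and cancel in \<open>H_nc\<close>,
  which leaves \<open>H_comp (source f) \<le> H_comp (target f)\<close>. This is the entropy
  condition of \<open>Comp_f_iff\<close> for \<open>Q_ar f\<close>.\<close>

lemma Phy_f_iff: "f \<in> Phy_f \<longleftrightarrow> phy_transformation f \<and> Q_ar f \<in> Comp_f"
  by (auto simp: Phy_f_def Comp_f_iff Phy_simps non_entropy_ejecting_def H_nc_def H_phy_def
      H_comp_def comp_transformation_Q_ar phy_transformationD(7) Q_ar_simps)

lemma wide_subcategory_Comp_f: "wide_subcategory Comp Comp_f"
  unfolding wide_subcategory_def
proof (intro conjI ballI impI)
  show "Comp_f \<subseteq> Ar Comp"
    by (auto simp: Comp_f_def)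
next
  fix a :: "'a comp_context"
  assume "a \<in> Ob Comp"
  then have "Idn Comp a \<in> Ar Comp"
    using category.ident[OF category_Comp] by blast
  then show "Idn Comp a \<in> Comp_f"
    by (auto simp: Comp_f_iff Comp_def det_transformation_def deterministic_id)
next
  fix f g :: "('a comp_context, 'a) transformation"
  assume f: "f \<in> Comp_f" and g: "g \<in> Comp_f" and fg: "Cod Comp f = Dom Comp g"
  then have "Cmp Comp f g \<in> Ar Comp"
    using category.comp[OF category_Comp] by (auto simp: Comp_f_def)
  then show "Cmp Comp f g \<in> Comp_f"
    using f g fg
    by (auto simp: Comp_f_iff Comp_def det_transformation_def intro: deterministic_mult)
qed

text \<open>By \<open>Phy_f_iff\<close> the free physical transformations are the preimage of
  \<open>Comp_f\<close> under aggregation, and the closure properties pull back along a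
  functor.\<close>

lemma wide_subcategory_Phy_f: "wide_subcategory Phy Phy_f"
  unfolding wide_subcategory_def
proof (intro conjI ballI impI)
  show "Phy_f \<subseteq> Ar Phy"
    by (auto simp: Phy_f_def)
next
  fix a :: "'a phy_context"
  assume a: "a \<in> Ob Phy"
  then have "Idn Phy a \<in> Ar Phy"
    using category.ident[OF category_Phy] by blast
  moreover have "Idn Comp (Q_ob a) \<in> Comp_f"
    using a wide_subcategory_Comp_f comp_context_Q_ob[of a]
    by (metis Comp_simps(1) Phy_simps(1) mem_Collect_eq wide_subcategory_def)
  ultimately show "Idn Phy a \<in> Phy_f"
    using a by (simp add: Phy_f_iff Phy_simps Q_ar_Idn)
next
  fix f g :: "('a phy_context, 'a) transformation"
  assume f: "f \<in> Phy_f" and g: "g \<in> Phy_f" and fg: "Cod Phy f = Dom Phy g"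
  then have "Cmp Phy f g \<in> Ar Phy"
    using category.comp[OF category_Phy] by (auto simp: Phy_f_def)
  moreover have "Cmp Comp (Q_ar f) (Q_ar g) \<in> Comp_f"
    using f g fg wide_subcategory_Comp_f
    by (auto simp: wide_subcategory_def Phy_f_iff Phy_simps Comp_simps Q_ar_simps)
  ultimately show "Cmp Phy f g \<in> Phy_f"
    using f g fg by (simp add: Phy_f_iff Phy_simps Q_ar_Cmp)
qed

theorem theorem4p31:
  shows "is_functor (Phy :: ('a phy_context, ('a phy_context, 'a) transformation) precategory) Comp Q \<and>
    resource_functor
      (Phy :: ('a phy_context, ('a phy_context, 'a) transformation) precategory, Phy_f)
      (Comp, Comp_f) Q \<and>
    resource_reflecting
      (Phy :: ('a phy_context, ('a phy_context, 'a) transformation) precategory, Phy_f)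
      (Comp, Comp_f) Q"
  \<comment> \<open>Preservation and reflection of free transformations are the two directions of
    \<open>Phy_f_iff\<close>.\<close>
  unfolding resource_functor_def resource_reflecting_def resource_theory_def prod.case
  using is_functor_Q category_Phy category_Comp wide_subcategory_Phy_f wide_subcategory_Comp_f
  by (auto simp: Q_def Phy_f_iff Phy_simps)

end
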